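(* Let $a,b:[0,\infty)\to[0,1]$ be functions with $a(t)+b(t)\leq 1$ for all $t\ge 0$, and let $$C_t=a(t)\,W+\bigl(1-a(t)-b(t)\bigr)\,\Pi+b(t)\,M,\qquad t\geq 0,$$ where $C_t$ is the copula of $(X_s,X_{s+t})$ for a time-homogeneous Markov process, so that $C_0=M$ and $C_{s+t}=C_s\ast C_t$ for all $s,t\geq 0$. Then one of the following holds: (i) there are constants $\lambda,\mu\geq 0$ such that for all $t\geq 0$ $$C_t=e^{-(\lambda+\mu)t}\sinh(\mu t)\,W+(1-e^{-\lambda t})\,\Pi+e^{-(\lambda+\mu)t}\cosh(\mu t)\,M;$$ equivalently, with $N_\Pi$ and $N_W$ independent Poisson processes of intensities $\lambda$ and $\mu$ respectively, $$C_t=\mathbb{P}\bigl(N_W(t)\text{ is odd},\,N_\Pi(t)=0\bigr)W+\mathbb{P}\bigl(N_\Pi(t)\geq 1\bigr)\Pi+\mathbb{P}\bigl(N_W(t)\text{ is even},\,N_\Pi(t)=0\bigr)M;$$ (ii) there is a constant $\lambda\geq 0$ such that $C_t=e^{-\lambda t}\bigl(\tfrac12W+\tfrac12M\bigr)+(1-e^{-\lambda t})\Pi$ for all $t>0$; (iii) $C_t=\Pi$ for all $t>0$.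
   Context: A (two-dimensional) copula is the joint distribution function of a random vector whose two marginals are uniform on $[0,1]$. Notation on $[0,1]^2$: $\Pi(x,y)=xy$, $M(x,y)=\min(x,y)$, $W(x,y)=\max(x+y-1,0)$. Convex combinations of $W,\Pi,M$ are called Fréchet copulas. The Markov product $C\ast D$ of two copulas is defined as follows: if $X_0,X_1,X_2$ is a Markov chain with uniform marginals on $[0,1]$ such that $(X_0,X_1)$ has joint distribution function $C$ and $(X_1,X_2)$ has joint distribution function $D$, then $C\ast D$ is the joint distribution function of $(X_0,X_2)$. Equivalently, $(C\ast D)(x,y)=\int_0^1 \partial_2C(x,u)\,\partial_1D(u,y)\,du$. If $(X_t)_{t\ge0}$ is a time-homogeneous Markov process and $C_t$ denotes the copula of $(X_s,X_{s+t})$ (the same for all $s\geq 0$), then $C_0=M$ and $C_{s+t}=C_s\ast C_t$ for all $s,t\geq0$; only these two properties of the family $(C_t)_{t\ge 0}$ are meant as the hypothesis. *)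

theory Defs
  imports "HOL-Probability.Probability"
begin

text \<open>
  Copulas are functions \<open>real \<Rightarrow> real \<Rightarrow> real\<close> of which only the values on the unit square
  \<open>[0,1]\<^sup>2\<close> matter, so equality of copulas is equality there.
\<close>

definition copula_eq :: "(real \<Rightarrow> real \<Rightarrow> real) \<Rightarrow> (real \<Rightarrow> real \<Rightarrow> real) \<Rightarrow> bool"
    (infix "=\<^sub>C" 50)
  where "C =\<^sub>C D \<longleftrightarrow> (\<forall>x\<in>{0..1}. \<forall>y\<in>{0..1}. C x y = D x y)"

definition cop_Pi :: "real \<Rightarrow> real \<Rightarrow> real"
  where "cop_Pi x y = x * y"

definition cop_M :: "real \<Rightarrow> real \<Rightarrow> real"
  where "cop_M x y = min x y"

definition cop_W :: "real \<Rightarrow> real \<Rightarrow> real"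
  where "cop_W x y = max (x + y - 1) 0"

definition frechet :: "real \<Rightarrow> real \<Rightarrow> real \<Rightarrow> real \<Rightarrow> real \<Rightarrow> real"
  where "frechet w p m x y = w * cop_W x y + p * cop_Pi x y + m * cop_M x y"

definition uniform01 :: "'w measure \<Rightarrow> ('w \<Rightarrow> real) \<Rightarrow> bool"
  where "uniform01 P X \<longleftrightarrow>
    X \<in> borel_measurable P \<and> distr P borel X = uniform_measure lborel {0..1}"

definition joint_cdf :: "'w measure \<Rightarrow> ('w \<Rightarrow> real) \<Rightarrow> ('w \<Rightarrow> real) \<Rightarrow> real \<Rightarrow> real \<Rightarrow> real"
  where "joint_cdf P X Y x y = measure P {\<omega> \<in> space P. X \<omega> \<le> x \<and> Y \<omega> \<le> y}"

text \<open>
  The Markov property of a chain with three time points: for every Borel set \<open>B\<close>, almost surely,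
  \<open>P(Z \<in> B | X, Y) = P(Z \<in> B | Y)\<close>.
\<close>

definition markov_chain3 ::
    "'w measure \<Rightarrow> ('w \<Rightarrow> real) \<Rightarrow> ('w \<Rightarrow> real) \<Rightarrow> ('w \<Rightarrow> real) \<Rightarrow> bool"
  where "markov_chain3 P X Y Z \<longleftrightarrow>
    prob_space P \<and>
    X \<in> borel_measurable P \<and> Y \<in> borel_measurable P \<and> Z \<in> borel_measurable P \<and>
    (\<forall>B \<in> sets borel. AE \<omega> in P.
       real_cond_exp P (vimage_algebra (space P) (\<lambda>\<omega>. (X \<omega>, Y \<omega>)) borel)
         (\<lambda>\<omega>. indicator B (Z \<omega>)) \<omega> =
       real_cond_exp P (vimage_algebra (space P) Y borel)
         (\<lambda>\<omega>. indicator B (Z \<omega>)) \<omega>)"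

text \<open>
  \<open>markov_product C D E\<close> says that \<open>E = C * D\<close> is the Markov product of \<open>C\<close> and \<open>D\<close>. It is a
  relation because the product is determined only through a Markov chain realising \<open>C\<close> and \<open>D\<close>; the
  law of \<open>(X0, X2)\<close> does not depend on which chain is chosen. Fixing the type of the sample space
  loses nothing, as every chain may be replaced by the coordinates under its law on \<open>\<real>\<^sup>3\<close>.
\<close>

definition markov_product ::
    "(real \<Rightarrow> real \<Rightarrow> real) \<Rightarrow> (real \<Rightarrow> real \<Rightarrow> real) \<Rightarrow> (real \<Rightarrow> real \<Rightarrow> real) \<Rightarrow> bool"
  where "markov_product C D E \<longleftrightarrow>
    (\<exists>(P :: (real \<times> real \<times> real) measure) X0 X1 X2.
       markov_chain3 P X0 X1 X2 \<and>
       uniform01 P X0 \<and> uniform01 P X1 \<and> uniform01 P X2 \<and>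
       joint_cdf P X0 X1 =\<^sub>C C \<and>
       joint_cdf P X1 X2 =\<^sub>C D \<and>
       joint_cdf P X0 X2 =\<^sub>C E)"

text \<open>
  Poisson processes indexed by \<open>[0,\<infinity>)\<close>; intensity \<open>0\<close> is allowed and gives the process that is
  constantly zero (as \<open>0 ^ 0 = 1\<close>). The law of an increment is phrased additively, and independence
  in type \<open>int\<close>, to avoid truncated subtraction.
\<close>

definition poisson_process :: "'w measure \<Rightarrow> real \<Rightarrow> (real \<Rightarrow> 'w \<Rightarrow> nat) \<Rightarrow> bool"
  where "poisson_process P l N \<longleftrightarrow>
    prob_space P \<and> 0 \<le> l \<and>
    (\<forall>t\<ge>0. N t \<in> measurable P (count_space UNIV)) \<and>
    (AE \<omega> in P. N 0 \<omega> = 0 \<and> mono_on {0..} (\<lambda>t. N t \<omega>) \<and>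
       (\<forall>t\<ge>0. continuous (at_right t) (\<lambda>u. real (N u \<omega>)))) \<and>
    (\<forall>s\<ge>0. \<forall>t\<ge>s. \<forall>k. measure P {\<omega> \<in> space P. N t \<omega> = N s \<omega> + k} =
       exp (- (l * (t - s))) * (l * (t - s)) ^ k / fact k) \<and>
    (\<forall>n (\<tau> :: nat \<Rightarrow> real). 0 \<le> \<tau> 0 \<longrightarrow> mono \<tau> \<longrightarrow>
       prob_space.indep_vars P (\<lambda>_. count_space UNIV)
         (\<lambda>i \<omega>. int (N (\<tau> (Suc i)) \<omega>) - int (N (\<tau> i) \<omega>)) {..<n})"

definition indep_processes ::
    "'w measure \<Rightarrow> (real \<Rightarrow> 'w \<Rightarrow> nat) \<Rightarrow> (real \<Rightarrow> 'w \<Rightarrow> nat) \<Rightarrow> bool"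
  where "indep_processes P N N' \<longleftrightarrow>
    prob_space.indep_var P
      (Pi\<^sub>M {0..} (\<lambda>_. count_space UNIV)) (\<lambda>\<omega>. \<lambda>t\<in>{0..}. N t \<omega>)
      (Pi\<^sub>M {0..} (\<lambda>_. count_space UNIV)) (\<lambda>\<omega>. \<lambda>t\<in>{0..}. N' t \<omega>)"

end

theory Submission
  imports Defs
begin

text \<open>
  If \<open>(Y, Z)\<close> has a Frechet copula, then \<open>P(Z \<le> y | Y)\<close> is an explicit step function of \<open>Y\<close>, so the
  Markov product with a Frechet copula can be computed: the reflection \<open>W\<close> is an involution,
  \<open>M\<close> is the unit and \<open>\<Pi>\<close> is absorbing. Hence \<open>a + b\<close> and \<open>b - a\<close> are both multiplicative in
  \<open>t\<close>, with values in \<open>[0,1]\<close> for \<open>t > 0\<close>, and so each is either zero on \<open>t > 0\<close> or an exponential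
  \<open>exp (- c t)\<close>. The three alternatives are: neither vanishes, only \<open>b - a\<close> vanishes, \<open>a + b\<close> vanishes.
\<close>

section \<open>Conditional expectations given a real random variable\<close>

text \<open>Each integral is the mass of \<open>B\<close> under the image by \<open>Y\<close> of the
  measure with density \<open>f\<close> or \<open>g\<close>. These images are finite Borel measures
  on the line, hence determined by their distribution functions.\<close>

lemma integral_indicator_eq_if_atMost:
  fixes Y :: "'w \<Rightarrow> real" and f g :: "'w \<Rightarrow> real"
  assumes f: "integrable M f" "\<And>\<omega>. 0 \<le> f \<omega>"
    and g: "integrable M g" "\<And>\<omega>. 0 \<le> g \<omega>"
    and Y: "Y \<in> borel_measurable M"
    and eq: "\<And>v. (\<integral>\<omega>. indicator {..v} (Y \<omega>) * f \<omega> \<partial>M) = (\<integral>\<omega>. indicator {..v} (Y \<omega>) * g \<omega> \<partial>M)"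
    and B: "B \<in> sets borel"
  shows "(\<integral>\<omega>. indicator B (Y \<omega>) * f \<omega> \<partial>M) = (\<integral>\<omega>. indicator B (Y \<omega>) * g \<omega> \<partial>M)"
proof -
  define \<mu> where "\<mu> h = distr (density M (\<lambda>\<omega>. ennreal (h \<omega>))) borel Y" for h :: "'w \<Rightarrow> real"
  note [measurable] = Y
  have em: "emeasure (\<mu> h) A = ennreal (\<integral>\<omega>. indicator A (Y \<omega>) * h \<omega> \<partial>M)"
    if h: "integrable M h" "\<And>\<omega>. 0 \<le> h \<omega>" and [measurable]: "A \<in> sets borel" for h A
  proof -
    have [measurable]: "h \<in> borel_measurable M"
      using h by auto
    have int: "integrable M (\<lambda>\<omega>. indicator A (Y \<omega>) * h \<omega>)"
      by (rule Bochner_Integration.integrable_bound[OF h(1)])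
        (use h(2) in \<open>auto split: split_indicator\<close>)
    have "emeasure (\<mu> h) A = emeasure (density M (\<lambda>\<omega>. ennreal (h \<omega>))) (Y -` A \<inter> space M)"
      by (simp add: \<mu>_def emeasure_distr)
    also have "\<dots> = (\<integral>\<^sup>+ \<omega>. ennreal (h \<omega>) * indicator (Y -` A \<inter> space M) \<omega> \<partial>M)"
      by (rule emeasure_density) auto
    also have "\<dots> = (\<integral>\<^sup>+ \<omega>. ennreal (indicator A (Y \<omega>) * h \<omega>) \<partial>M)"
      by (rule nn_integral_cong) (auto split: split_indicator)
    also have "\<dots> = ennreal (\<integral>\<omega>. indicator A (Y \<omega>) * h \<omega> \<partial>M)"
      by (rule nn_integral_eq_integral[OF int]) (use h(2) in auto)
    finally show ?thesis .
  qed
  have me: "measure (\<mu> h) A = (\<integral>\<omega>. indicator A (Y \<omega>) * h \<omega> \<partial>M)"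
    if h: "integrable M h" "\<And>\<omega>. 0 \<le> h \<omega>" and "A \<in> sets borel" for h A
    using em[OF that] h(2) by (simp add: measure_def integral_nonneg_AE)
  have fin: "finite_borel_measure (\<mu> h)" if h: "integrable M h" "\<And>\<omega>. 0 \<le> h \<omega>" for h
  proof (rule finite_borel_measure.intro[OF finite_measureI])
    show "emeasure (\<mu> h) (space (\<mu> h)) \<noteq> \<infinity>"
      using em[OF h, of UNIV] by (simp add: \<mu>_def)
  qed (simp add: finite_borel_measure_axioms_def \<mu>_def)
  have "\<mu> f = \<mu> g"
    by (rule cdf_unique'[OF fin[OF f] fin[OF g]])
      (simp add: fun_eq_iff cdf_def me f g eq)
  then show ?thesis
    using me[OF f B] me[OF g B] by simp
qed

lemma subalgebra_vimage_algebra: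
  assumes "X \<in> measurable M N"
  shows "subalgebra M (vimage_algebra (space M) X N)"
  using assms measurable_sets[OF assms] measurable_space[OF assms]
  by (auto simp: subalgebra_def sets_vimage_algebra2 space_vimage_algebra)

lemma (in prob_space) sigma_finite_subalgebra_vimage_algebra:
  assumes "X \<in> measurable M N"
  shows "sigma_finite_subalgebra M (vimage_algebra (space M) X N)"
  by (rule finite_measure_subalgebra_is_sigma_finite)
    (unfold_locales, rule subalgebra_vimage_algebra[OF assms])

text \<open>Every event generated by \<open>Y\<close> has the form \<open>Y \<in> B\<close>, so the
  characterising identity of the conditional expectation is one about Borel sets \<open>B\<close>,
  and half-lines suffice for it. This is what makes a guess \<open>k\<close> checkable against a
  distribution function.\<close>

lemma (in prob_space) real_cond_exp_vimage_algebra_eqI: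
  fixes Y f :: "'a \<Rightarrow> real" and k :: "real \<Rightarrow> real"
  assumes Y: "Y \<in> borel_measurable M"
    and f: "integrable M f" "\<And>\<omega>. 0 \<le> f \<omega>"
    and k: "k \<in> borel_measurable borel" "integrable M (\<lambda>\<omega>. k (Y \<omega>))" "\<And>u. 0 \<le> k u"
    and eq: "\<And>v. (\<integral>\<omega>. indicator {..v} (Y \<omega>) * f \<omega> \<partial>M) = (\<integral>\<omega>. indicator {..v} (Y \<omega>) * k (Y \<omega>) \<partial>M)"
  shows "AE \<omega> in M. real_cond_exp M (vimage_algebra (space M) Y borel) f \<omega> = k (Y \<omega>)"
proof -
  interpret sigma_finite_subalgebra M "vimage_algebra (space M) Y borel"
    by (rule sigma_finite_subalgebra_vimage_algebra[OF Y])
  show ?thesis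
  proof (rule real_cond_exp_charact)
    fix A assume "A \<in> sets (vimage_algebra (space M) Y borel)"
    then obtain B where B: "B \<in> sets borel" "A = Y -` B \<inter> space M"
      by (auto simp: sets_vimage_algebra2)
    have *: "(\<integral>\<omega>\<in>A. h \<omega> \<partial>M) = (\<integral>\<omega>. indicator B (Y \<omega>) * h \<omega> \<partial>M)" for h :: "'a \<Rightarrow> real"
      unfolding set_lebesgue_integral_def B(2)
      by (rule Bochner_Integration.integral_cong) (auto split: split_indicator)
    show "(\<integral>\<omega>\<in>A. f \<omega> \<partial>M) = (\<integral>\<omega>\<in>A. k (Y \<omega>) \<partial>M)"
      unfolding * by (rule integral_indicator_eq_if_atMost[OF f k(2) k(3) Y eq B(1)])
  next
    show "(\<lambda>\<omega>. k (Y \<omega>)) \<in> borel_measurable (vimage_algebra (space M) Y borel)"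
      by (rule measurable_compose[OF measurable_vimage_algebra1 k(1)]) auto
  qed (use f k in auto)
qed

section \<open>Events of uniform variables\<close>

lemma uniform01_prob:
  assumes "uniform01 P Y" "A \<in> sets borel"
  shows "measure P {\<omega> \<in> space P. Y \<omega> \<in> A} = measure lborel ({0..1} \<inter> A)"
proof -
  have Y: "Y \<in> borel_measurable P" and d: "distr P borel Y = uniform_measure lborel {0..1}"
    using assms by (auto simp: uniform01_def)
  have "measure P {\<omega> \<in> space P. Y \<omega> \<in> A} = measure (distr P borel Y) A"
    by (subst measure_distr[OF Y assms(2)]) (auto intro!: arg_cong[where f="measure P"])
  also have "\<dots> = measure lborel ({0..1} \<inter> A)"
    using assms(2) unfolding d by (subst measure_uniform_measure) auto
  finally show ?thesis .
qed

lemma uniform01_AE: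
  assumes "uniform01 P Y"
  shows "AE \<omega> in P. 0 \<le> Y \<omega> \<and> Y \<omega> \<le> 1"
proof -
  have Y: "Y \<in> borel_measurable P" and d: "distr P borel Y = uniform_measure lborel {0..1}"
    using assms by (auto simp: uniform01_def)
  have "AE u in distr P borel Y. u \<in> {0..1}"
    unfolding d by (rule AE_uniform_measureI) auto
  then show ?thesis
    by (subst (asm) AE_distr_iff[OF Y]) auto
qed

lemma uniform01_prob_atMost:
  assumes "uniform01 P Y" "0 \<le> v" "v \<le> 1"
  shows "measure P {\<omega> \<in> space P. Y \<omega> \<le> v} = v"
proof -
  have "{0..1} \<inter> {..v} = {0..v}" using assms by auto
  then show ?thesis
    using uniform01_prob[OF assms(1), of "{..v}"] assms by simp
qed

lemma uniform01_prob_Icc: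
  assumes "uniform01 P Y" "0 \<le> u" "v \<le> 1"
  shows "measure P {\<omega> \<in> space P. u \<le> Y \<omega> \<and> Y \<omega> \<le> v} = max (v - u) 0"
proof -
  have "{0..1} \<inter> {u..v} = {u..v}" using assms by auto
  then show ?thesis
    using uniform01_prob[OF assms(1), of "{u..v}"] by (auto simp: max_def)
qed

lemma uniform01_prob_singleton:
  assumes "uniform01 P Y"
  shows "measure P {\<omega> \<in> space P. Y \<omega> = v} = 0"
proof -
  have "measure lborel ({0..1} \<inter> {v}) = 0"
    by (cases "v \<in> {0..1}") auto
  then show ?thesis
    using uniform01_prob[OF assms, of "{v}"] by simp
qed

section \<open>Multiplicative functions on the positive half-line\<close>

text \<open>A single zero \<open>t0\<close> yields zeros \<open>t0 / 2 ^ n\<close> by halving, and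
  these reach below any \<open>t > 0\<close>, where they kill a factor of \<open>f t\<close>.
  Without zeros, \<open>- ln f\<close> is additive and nonnegative, hence monotone, and monotone
  additive functions are linear; continuity is a consequence, not an assumption.\<close>

lemma bounded_multiplicative_zero_or_exp:
  fixes f :: "real \<Rightarrow> real"
  assumes nn: "\<And>t. t > 0 \<Longrightarrow> 0 \<le> f t" and le: "\<And>t. t > 0 \<Longrightarrow> f t \<le> 1"
    and mult: "\<And>s t. s > 0 \<Longrightarrow> t > 0 \<Longrightarrow> f (s + t) = f s * f t"
  shows "(\<forall>t>0. f t = 0) \<or> (\<exists>l\<ge>0. \<forall>t>0. f t = exp (- l * t))"
proof (cases "\<exists>t>0. f t = 0")
  case True
  then obtain t0 where t0: "t0 > 0" "f t0 = 0" by auto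
  have halves: "f (t0 / 2 ^ n) = 0" for n
  proof (induction n)
    case (Suc n)
    have "f (t0 / 2 ^ n) = f (t0 / 2 ^ Suc n) * f (t0 / 2 ^ Suc n)"
      using mult[of "t0 / 2 ^ Suc n" "t0 / 2 ^ Suc n"] t0 by (simp add: field_simps)
    with Suc show ?case by simp
  qed (use t0 in simp)
  have "f t = 0" if "t > 0" for t
  proof -
    obtain n where "t0 / t < 2 ^ n"
      using real_arch_pow[of 2] by auto
    then have "t0 / 2 ^ n < t"
      using that by (simp add: field_simps)
    then show ?thesis
      using mult[of "t0 / 2 ^ n" "t - t0 / 2 ^ n"] halves[of n] t0 by simp
  qed
  then show ?thesis by blast
next
  case False
  then have pos: "f t > 0" if "t > 0" for t
    using nn[OF that] that by force
  define g where "g t = - ln (f t)" for t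
  have g_nn: "g t \<ge> 0" if "t > 0" for t
    using le[OF that] pos[OF that] by (simp add: g_def)
  have g_add: "g (s + t) = g s + g t" if "s > 0" "t > 0" for s t
    using pos[OF that(1)] pos[OF that(2)] that by (simp add: g_def mult ln_mult)
  have g_mono: "g s \<le> g t" if "0 < s" "s \<le> t" for s t
    using g_add[of s "t - s"] g_nn[of "t - s"] that by (cases "s = t") auto
  have g_nat: "g (real (Suc n) * t) = real (Suc n) * g t" if "t > 0" for n t
  proof (induction n)
    case (Suc n)
    have "g (real (Suc (Suc n)) * t) = g (real (Suc n) * t + t)"
      by (simp add: algebra_simps)
    also have "\<dots> = g (real (Suc n) * t) + g t"
      using that by (intro g_add) auto
    also have "\<dots> = real (Suc (Suc n)) * g t"
      unfolding Suc by (simp add: algebra_simps)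
    finally show ?case .
  qed simp
  have g_nat1: "g (real n) = real n * g 1" if "n > 0" for n
    using g_nat[of 1 "n - 1"] that by simp
  have lin: "g t = t * g 1" if t: "t > 0" for t
  proof -
    \<comment> \<open>With \<open>x\<close> between the integers \<open>k\<close> and
      \<open>Suc k\<close>, both \<open>g x\<close> and \<open>x * g 1\<close> lie between
      \<open>k * g 1\<close> and \<open>Suc k * g 1\<close>, so they differ by at most
      \<open>g 1\<close>. Since \<open>x\<close> is \<open>Suc n\<close> times \<open>t\<close>, the
      difference at \<open>t\<close> is at most \<open>g 1 / Suc n\<close> for every
      \<open>n\<close>, hence zero.\<close>
    have bound: "real (Suc n) * \<bar>g t - t * g 1\<bar> \<le> g 1" for n
    proof -
      define x where "x = real (Suc n) * t"
      define k where "k = nat \<lfloor>x\<rfloor>"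
      have x: "x > 0" using t by (simp add: x_def)
      have k: "real k \<le> x" "x \<le> real (Suc k)"
        using x unfolding k_def by linarith+
      have up: "g x \<le> real (Suc k) * g 1"
        using g_mono[OF x k(2)] g_nat1[of "Suc k"] by simp
      \<comment> \<open>The case \<open>k = 0\<close> is separate because \<open>g\<close> is
        controlled only at positive arguments; there nonnegativity of \<open>g x\<close> is
        enough.\<close>
      have low: "real k * g 1 \<le> g x"
        using g_mono[OF _ k(1)] g_nat1[of k] g_nn[OF x] by (cases "k = 0") auto
      have "real k * g 1 \<le> x * g 1" "x * g 1 \<le> real (Suc k) * g 1"
        using k g_nn[of 1] by (auto intro!: mult_right_mono)
      with up low have "\<bar>g x - x * g 1\<bar> \<le> g 1"
        by (auto simp: algebra_simps abs_le_iff)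
      also have "g x - x * g 1 = real (Suc n) * (g t - t * g 1)"
        unfolding x_def g_nat[OF t] by (simp add: algebra_simps)
      finally show ?thesis by (simp add: abs_mult)
    qed
    show ?thesis
    proof (rule ccontr)
      assume "g t \<noteq> t * g 1"
      then have d: "\<bar>g t - t * g 1\<bar> > 0" by simp
      obtain n where "g 1 < real n * \<bar>g t - t * g 1\<bar>"
        using reals_Archimedean3[OF d] by blast
      also have "\<dots> \<le> real (Suc n) * \<bar>g t - t * g 1\<bar>"
        by (rule mult_right_mono) auto
      finally show False using bound[of n] by simp
    qed
  qed
  have "f t = exp (- g 1 * t)" if "t > 0" for t
    using lin[OF that] pos[OF that] by (metis exp_ln g_def minus_minus mult.commute mult_minus_left)
  then show ?thesis using g_nn[of 1] by (intro disjI2 exI[of _ "g 1"]) auto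
qed


section \<open>Markov products with a Frechet copula\<close>

text \<open>Equality of copulas speaks only of the unit square, whereas half-lines have arbitrary
  endpoints \<open>v\<close>; this reduces the latter to the former.\<close>

lemma joint_cdf_clamp:
  assumes "uniform01 P X" "Y \<in> borel_measurable P"
  shows "joint_cdf P X Y v y = (if v < 0 then 0 else joint_cdf P X Y (min v 1) y)"
proof -
  have [measurable]: "X \<in> borel_measurable P" "Y \<in> borel_measurable P"
    using assms by (auto simp: uniform01_def)
  \<comment> \<open>Almost surely \<open>X\<close> lies in the unit interval, so
    \<open>X \<le> v\<close> amounts to \<open>0 \<le> v\<close> together with
    \<open>X \<le> min v 1\<close>.\<close>
  have "joint_cdf P X Y v y = measure P {\<omega> \<in> space P. 0 \<le> v \<and> X \<omega> \<le> min v 1 \<and> Y \<omega> \<le> y}"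
    unfolding joint_cdf_def
    by (rule measure_eq_AE) (use uniform01_AE[OF assms(1)] in auto)
  then show ?thesis by (auto simp: joint_cdf_def)
qed

text \<open>The candidate for P(Z \<le> y | Y = u) when \<open>(Y, Z)\<close> has copula
  \<open>frechet w p m\<close>: it mixes Z = 1 - Y, Z independent of Y, and Z = Y. On the unit
  interval it is almost everywhere the derivative of \<open>frechet w p m u y\<close> in
  \<open>u\<close>.\<close>

definition frechet_kernel :: "real \<Rightarrow> real \<Rightarrow> real \<Rightarrow> real \<Rightarrow> real \<Rightarrow> real"
  where "frechet_kernel w p m y u = w * indicator {1 - y..} u + p * y + m * indicator {..y} u"

lemma frechet_kernel_nonneg:
  "0 \<le> w \<Longrightarrow> 0 \<le> p \<Longrightarrow> 0 \<le> m \<Longrightarrow> 0 \<le> y \<Longrightarrow> 0 \<le> frechet_kernel w p m y u"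
  by (simp add: frechet_kernel_def)

lemma borel_measurable_frechet_kernel [measurable]:
  "frechet_kernel w p m y \<in> borel_measurable borel"
  unfolding frechet_kernel_def by measurable

text \<open>Two variables are allowed because both uses are needed: \<open>X\<close> equal to
  \<open>Y\<close> verifies the kernel as a conditional probability, and \<open>X\<close> as the
  preceding state of the chain computes the product.\<close>

lemma (in prob_space) integral_frechet_kernel:
  fixes X Y :: "'a \<Rightarrow> real"
  assumes [measurable]: "X \<in> borel_measurable M" "Y \<in> borel_measurable M"
  shows "(\<integral>\<omega>. indicator {..v} (X \<omega>) * frechet_kernel w p m y (Y \<omega>) \<partial>M) =
    w * prob {\<omega> \<in> space M. X \<omega> \<le> v \<and> 1 - y \<le> Y \<omega>} + p * y * prob {\<omega> \<in> space M. X \<omega> \<le> v}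
    + m * prob {\<omega> \<in> space M. X \<omega> \<le> v \<and> Y \<omega> \<le> y}"
proof -
  let ?A = "{\<omega> \<in> space M. X \<omega> \<le> v \<and> 1 - y \<le> Y \<omega>}"
  let ?B = "{\<omega> \<in> space M. X \<omega> \<le> v}"
  let ?D = "{\<omega> \<in> space M. X \<omega> \<le> v \<and> Y \<omega> \<le> y}"
  have "(\<integral>\<omega>. indicator {..v} (X \<omega>) * frechet_kernel w p m y (Y \<omega>) \<partial>M) =
    (\<integral>\<omega>. w * indicator ?A \<omega> + p * y * indicator ?B \<omega> + m * indicator ?D \<omega> \<partial>M)"
    by (rule Bochner_Integration.integral_cong)
      (auto simp: frechet_kernel_def split: split_indicator)
  also have "\<dots> = (\<integral>\<omega>. w * indicator ?A \<omega> \<partial>M) + (\<integral>\<omega>. p * y * indicator ?B \<omega> \<partial>M)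
      + (\<integral>\<omega>. m * indicator ?D \<omega> \<partial>M)"
  proof -
    have [measurable]: "?A \<in> sets M" "?B \<in> sets M" "?D \<in> sets M" by measurable
    have "integrable M (\<lambda>\<omega>. w * indicator ?A \<omega>)" "integrable M (\<lambda>\<omega>. p * y * indicator ?B \<omega>)"
      "integrable M (\<lambda>\<omega>. m * indicator ?D \<omega>)"
      by (intro integrable_mult_right integrable_real_indicator; simp add: emeasure_eq_measure)+
    then show ?thesis
      by (simp only: Bochner_Integration.integral_add Bochner_Integration.integrable_add)
  qed
  also have "\<dots> = w * prob ?A + p * y * prob ?B + m * prob ?D"
    by simp
  finally show ?thesis .
qed

lemma (in prob_space) integrable_frechet_kernel:
  assumes [measurable]: "Y \<in> borel_measurable M"
  shows "integrable M (\<lambda>\<omega>. frechet_kernel w p m y (Y \<omega>))"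
proof (rule integrable_const_bound[where B="\<bar>w\<bar> + \<bar>p * y\<bar> + \<bar>m\<bar>"])
  show "AE \<omega> in M. norm (frechet_kernel w p m y (Y \<omega>)) \<le> \<bar>w\<bar> + \<bar>p * y\<bar> + \<bar>m\<bar>"
    by (rule AE_I2) (auto simp: frechet_kernel_def split: split_indicator)
qed measurable

text \<open>Integrating the kernel over \<open>Y \<le> v\<close> gives back
  \<open>frechet w p m v y\<close> term by term, because \<open>Y\<close> is uniform; testing on
  half-lines then identifies the conditional probability.\<close>

lemma real_cond_exp_frechet:
  assumes "prob_space P" and Y: "uniform01 P Y" and Z: "uniform01 P Z"
    and cdf: "joint_cdf P Y Z =\<^sub>C frechet w p m"
    and nn: "0 \<le> w" "0 \<le> p" "0 \<le> m" and y: "y \<in> {0..1}"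
  shows "AE \<omega> in P. real_cond_exp P (vimage_algebra (space P) Y borel)
      (\<lambda>\<omega>. indicator {..y} (Z \<omega>)) \<omega> = frechet_kernel w p m y (Y \<omega>)"
proof -
  interpret prob_space P by fact
  have [measurable]: "Y \<in> borel_measurable P" "Z \<in> borel_measurable P"
    using Y Z by (auto simp: uniform01_def)
  show ?thesis
  proof (rule real_cond_exp_vimage_algebra_eqI)
    fix v
    have L: "(\<integral>\<omega>. indicator {..v} (Y \<omega>) * (indicator {..y} (Z \<omega>) :: real) \<partial>P) = joint_cdf P Y Z v y" for v
    proof -
      have "(\<integral>\<omega>. indicator {..v} (Y \<omega>) * (indicator {..y} (Z \<omega>) :: real) \<partial>P) =
          (\<integral>\<omega>. indicator {\<omega> \<in> space P. Y \<omega> \<le> v \<and> Z \<omega> \<le> y} \<omega> \<partial>P)"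
        by (rule Bochner_Integration.integral_cong) (auto split: split_indicator)
      then show ?thesis by (simp add: joint_cdf_def)
    qed
    \<comment> \<open>The kernel side is clamped in the same way as the distribution function, so
      that only \<open>v\<close> in the unit interval remains to be compared.\<close>
    have R: "(\<integral>\<omega>. indicator {..v} (Y \<omega>) * frechet_kernel w p m y (Y \<omega>) \<partial>P) =
        (if v < 0 then 0 else \<integral>\<omega>. indicator {..min v 1} (Y \<omega>) * frechet_kernel w p m y (Y \<omega>) \<partial>P)"
    proof -
      have "(\<integral>\<omega>. indicator {..v} (Y \<omega>) * frechet_kernel w p m y (Y \<omega>) \<partial>P) =
        (\<integral>\<omega>. (if v < 0 then 0 else indicator {..min v 1} (Y \<omega>) * frechet_kernel w p m y (Y \<omega>)) \<partial>P)"
        by (rule integral_cong_AE)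
          (use uniform01_AE[OF Y] in \<open>auto split: split_indicator\<close>)
      then show ?thesis by simp
    qed
    have eq: "joint_cdf P Y Z v y =
        (\<integral>\<omega>. indicator {..v} (Y \<omega>) * frechet_kernel w p m y (Y \<omega>) \<partial>P)" if v: "v \<in> {0..1}" for v
    proof -
      have "{\<omega> \<in> space P. Y \<omega> \<le> v \<and> 1 - y \<le> Y \<omega>} = {\<omega> \<in> space P. 1 - y \<le> Y \<omega> \<and> Y \<omega> \<le> v}"
        by auto
      then have W: "prob {\<omega> \<in> space P. Y \<omega> \<le> v \<and> 1 - y \<le> Y \<omega>} = max (v - (1 - y)) 0"
        using uniform01_prob_Icc[OF Y, of "1 - y" v] v y by simp
      have "{\<omega> \<in> space P. Y \<omega> \<le> v \<and> Y \<omega> \<le> y} = {\<omega> \<in> space P. Y \<omega> \<le> min v y}"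
        by auto
      then have M: "prob {\<omega> \<in> space P. Y \<omega> \<le> v \<and> Y \<omega> \<le> y} = min v y"
        using uniform01_prob_atMost[OF Y, of "min v y"] v y by (simp only:) auto
      have "frechet w p m v y = w * max (v - (1 - y)) 0 + p * y * v + m * min v y"
        by (simp add: frechet_def cop_W_def cop_Pi_def cop_M_def algebra_simps)
      moreover have "joint_cdf P Y Z v y = frechet w p m v y"
        using cdf v y by (simp add: copula_eq_def)
      moreover have "prob {\<omega> \<in> space P. Y \<omega> \<le> v} = v"
        using uniform01_prob_atMost[OF Y] v by simp
      ultimately show ?thesis
        by (simp only: integral_frechet_kernel W M
            \<open>Y \<in> borel_measurable P\<close>)
    qed
    have "joint_cdf P Y Z v y = (if v < 0 then 0 else joint_cdf P Y Z (min v 1) y)"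
      by (rule joint_cdf_clamp[OF Y]) measurable
    also have "\<dots> = (\<integral>\<omega>. indicator {..v} (Y \<omega>) * frechet_kernel w p m y (Y \<omega>) \<partial>P)"
    proof (cases "v < 0")
      case True
      then show ?thesis by (subst R) simp
    next
      case False
      then have "min v 1 \<in> {0..1}" by auto
      from eq[OF this] False show ?thesis by (subst R) simp
    qed
    finally show "(\<integral>\<omega>. indicator {..v} (Y \<omega>) * indicator {..y} (Z \<omega>) \<partial>P) =
        (\<integral>\<omega>. indicator {..v} (Y \<omega>) * frechet_kernel w p m y (Y \<omega>) \<partial>P)"
      by (simp only: L)
  qed (use nn y in \<open>auto simp: frechet_kernel_nonneg integrable_frechet_kernel intro!: integrable_const_bound[where B=1]\<close>)
qed

text \<open>
  By the Markov property \<open>P(X\<^sub>0 \<le> x, X\<^sub>2 \<le> y)\<close> is the expectation of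
  \<open>1(X\<^sub>0 \<le> x) P(X\<^sub>2 \<le> y | X\<^sub>1)\<close>, and the kernel is a step function of \<open>X\<^sub>1\<close>.
\<close>
lemma markov_product_frechet_right:
  assumes mp: "markov_product C D E" and D: "D =\<^sub>C frechet w p m"
    and nn: "0 \<le> w" "0 \<le> p" "0 \<le> m" and x: "x \<in> {0..1}" and y: "y \<in> {0..1}"
  shows "E x y = w * (x - C x (1 - y)) + p * x * y + m * C x y"
proof -
  obtain P :: "(real \<times> real \<times> real) measure" and X0 X1 X2 where
    mc: "markov_chain3 P X0 X1 X2"
    and u: "uniform01 P X0" "uniform01 P X1" "uniform01 P X2"
    and cC: "joint_cdf P X0 X1 =\<^sub>C C" and cD: "joint_cdf P X1 X2 =\<^sub>C D"
    and cE: "joint_cdf P X0 X2 =\<^sub>C E"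
    using mp unfolding markov_product_def by blast
  interpret prob_space P using mc by (simp add: markov_chain3_def)
  have [measurable]: "X0 \<in> borel_measurable P" "X1 \<in> borel_measurable P" "X2 \<in> borel_measurable P"
    using u by (auto simp: uniform01_def)
  let ?F = "vimage_algebra (space P) (\<lambda>\<omega>. (X0 \<omega>, X1 \<omega>)) borel"
  let ?h = "\<lambda>\<omega>. indicator {..y} (X2 \<omega>) :: real"
  have pair: "(\<lambda>\<omega>. (X0 \<omega>, X1 \<omega>)) \<in> measurable P borel"
    by measurable
  interpret F: sigma_finite_subalgebra P ?F
    by (rule sigma_finite_subalgebra_vimage_algebra[OF pair])
  have "joint_cdf P X1 X2 =\<^sub>C frechet w p m"
    using cD D by (simp add: copula_eq_def)
  then have "AE \<omega> in P. real_cond_exp P (vimage_algebra (space P) X1 borel) ?h \<omega> =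
      frechet_kernel w p m y (X1 \<omega>)"
    by (rule real_cond_exp_frechet[OF prob_space_axioms u(2,3) _ nn y])
  moreover have "AE \<omega> in P. real_cond_exp P ?F ?h \<omega> =
      real_cond_exp P (vimage_algebra (space P) X1 borel) ?h \<omega>"
    using mc by (simp add: markov_chain3_def)
  ultimately have "AE \<omega> in P. real_cond_exp P ?F ?h \<omega> = frechet_kernel w p m y (X1 \<omega>)"
    by eventually_elim simp
  then have ae: "AE \<omega> in P. indicator {..x} (X0 \<omega>) * real_cond_exp P ?F ?h \<omega> =
      indicator {..x} (X0 \<omega>) * frechet_kernel w p m y (X1 \<omega>)"
    by auto
  \<comment> \<open>The event \<open>X0 \<le> x\<close> depends only on the first coordinate of the
    generating pair. Being measurable for \<open>?F\<close>, its indicator can be taken inside the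
    conditional expectation.\<close>
  have X0F: "(\<lambda>\<omega>. indicator {..x} (X0 \<omega>) :: real) \<in> borel_measurable ?F"
  proof -
    have "(\<lambda>z. indicator {..x} (fst z) :: real) \<in> borel_measurable (borel :: (real \<times> real) measure)"
      unfolding borel_prod[symmetric] by measurable
    from measurable_compose[OF measurable_vimage_algebra1 this, of "\<lambda>\<omega>. (X0 \<omega>, X1 \<omega>)" "space P"]
    show ?thesis by simp
  qed
  have "E x y = joint_cdf P X0 X2 x y"
    using cE x y by (simp add: copula_eq_def)
  also have "\<dots> = (\<integral>\<omega>. indicator {\<omega> \<in> space P. X0 \<omega> \<le> x \<and> X2 \<omega> \<le> y} \<omega> \<partial>P)"
    by (simp add: joint_cdf_def)
  also have "\<dots> = (\<integral>\<omega>. indicator {..x} (X0 \<omega>) * ?h \<omega> \<partial>P)"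
    by (rule Bochner_Integration.integral_cong) (auto split: split_indicator)
  \<comment> \<open>The \<open>?F\<close>-measurable factor allows \<open>?h\<close> to be replaced
    by its conditional expectation, which the Markov property has identified with the kernel at
    \<open>X1\<close>.\<close>
  also have "\<dots> = (\<integral>\<omega>. indicator {..x} (X0 \<omega>) * real_cond_exp P ?F ?h \<omega> \<partial>P)"
    by (rule F.real_cond_exp_intg(2)[symmetric])
      (auto intro!: X0F integrable_const_bound[where B=1] split: split_indicator)
  also have "\<dots> = (\<integral>\<omega>. indicator {..x} (X0 \<omega>) * frechet_kernel w p m y (X1 \<omega>) \<partial>P)"
    by (rule integral_cong_AE) (use ae measurable_from_subalg[OF F.subalg X0F] in auto)
  also have "\<dots> = w * prob {\<omega> \<in> space P. X0 \<omega> \<le> x \<and> 1 - y \<le> X1 \<omega>}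
      + p * y * prob {\<omega> \<in> space P. X0 \<omega> \<le> x} + m * joint_cdf P X0 X1 x y"
    by (simp add: integral_frechet_kernel joint_cdf_def)
  \<comment> \<open>The closed events \<open>1 - y \<le> X1\<close> and
    \<open>X1 \<le> 1 - y\<close> overlap in \<open>X1 = 1 - y\<close>, which is null because
    \<open>X1\<close> is uniform; up to this null set they are complementary.\<close>
  also have "prob {\<omega> \<in> space P. X0 \<omega> \<le> x \<and> 1 - y \<le> X1 \<omega>} = x - C x (1 - y)"
  proof -
    have "prob {\<omega> \<in> space P. X1 \<omega> = 1 - y} = 0"
      by (rule uniform01_prob_singleton[OF u(2)])
    then have "AE \<omega> in P. X1 \<omega> \<noteq> 1 - y"
      by (subst (asm) prob_eq_0) auto
    then have "prob {\<omega> \<in> space P. X0 \<omega> \<le> x \<and> 1 - y \<le> X1 \<omega>} =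
        prob ({\<omega> \<in> space P. X0 \<omega> \<le> x} - {\<omega> \<in> space P. X0 \<omega> \<le> x \<and> X1 \<omega> \<le> 1 - y})"
      by (intro measure_eq_AE) auto
    also have "\<dots> = prob {\<omega> \<in> space P. X0 \<omega> \<le> x} - joint_cdf P X0 X1 x (1 - y)"
      unfolding joint_cdf_def by (rule finite_measure_Diff) auto
    finally show ?thesis
      using cC x y by (simp add: uniform01_prob_atMost[OF u(1)] copula_eq_def)
  qed
  also have "prob {\<omega> \<in> space P. X0 \<omega> \<le> x} = x"
    using x by (simp add: uniform01_prob_atMost[OF u(1)])
  also have "joint_cdf P X0 X1 x y = C x y"
    using cC x y by (simp add: copula_eq_def)
  finally show ?thesis by (simp add: algebra_simps)
qed

text \<open>The product is again an explicit combination of \<open>cop_W\<close>,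
  \<open>cop_Pi\<close> and \<open>cop_M\<close>, so two well-chosen points determine its two free
  weights.\<close>

lemma markov_product_frechet_coeffs:
  assumes mp: "markov_product C D E" and C: "C =\<^sub>C frechet a (1 - a - b) b"
    and D: "D =\<^sub>C frechet a' (1 - a' - b') b'" and E: "E =\<^sub>C frechet a'' (1 - a'' - b'') b''"
    and nn: "0 \<le> a'" "0 \<le> b'" "a' + b' \<le> 1"
  shows "a'' + b'' = (a + b) * (a' + b')" "b'' - a'' = (b - a) * (b' - a')"
proof -
  have *: "frechet a'' (1 - a'' - b'') b'' x y =
      a' * (x - frechet a (1 - a - b) b x (1 - y)) + (1 - a' - b') * x * y
      + b' * frechet a (1 - a - b) b x y" if "x \<in> {0..1}" "y \<in> {0..1}" for x y
    using markov_product_frechet_right[OF mp D _ _ _ that] C E nn that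
    by (simp add: copula_eq_def)
  note ev = frechet_def cop_W_def cop_Pi_def cop_M_def
  \<comment> \<open>At this point W, \<Pi> and M equal 0, 1/4 and 1/2, so a Frechet copula with
    weights a, 1 - a - b, b has value (1 + (b - a)) / 4: only the difference enters.\<close>
  have half: "b'' - a'' = (b - a) * (b' - a')"
    using *[of "1/2" "1/2"] by (simp add: ev field_simps)
  then show "b'' - a'' = (b - a) * (b' - a')" .
  show "a'' + b'' = (a + b) * (a' + b')"
    \<comment> \<open>Here the value is (1 + (a + b) + 2 (b - a)) / 16, so the known difference
      leaves the sum.\<close>
    using *[of "1/4" "1/4"] half by (simp add: ev field_simps)
qed

section \<open>Poisson probabilities of the mixture weights\<close>

lemma poisson_process_prob_eq:
  assumes N: "poisson_process P l N" and t: "0 \<le> t"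
  shows "measure P {\<omega> \<in> space P. N t \<omega> = k} = exp (- (l * t)) * (l * t) ^ k / fact k"
proof -
  have [measurable]: "N t \<in> measurable P (count_space UNIV)" "N 0 \<in> measurable P (count_space UNIV)"
    using N t by (auto simp: poisson_process_def)
  \<comment> \<open>The process starts at zero only almost surely, so the increment event must be
    known measurable before it is compared with \<open>N t = k\<close>; splitting by the value of
    \<open>N 0\<close> shows this.\<close>
  have "{\<omega> \<in> space P. N t \<omega> = N 0 \<omega> + k} =
      (\<Union>j. {\<omega> \<in> space P. N 0 \<omega> = j \<and> N t \<omega> = j + k})"
    by auto
  also have "\<dots> \<in> sets P" by measurable
  finally have [measurable]: "{\<omega> \<in> space P. N t \<omega> = N 0 \<omega> + k} \<in> sets P" .
  have "measure P {\<omega> \<in> space P. N t \<omega> = k} = measure P {\<omega> \<in> space P. N t \<omega> = N 0 \<omega> + k}"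
    by (rule measure_eq_AE) (use N in \<open>auto simp: poisson_process_def\<close>)
  also have "\<dots> = exp (- (l * (t - 0))) * (l * (t - 0)) ^ k / fact k"
    using N t unfolding poisson_process_def by blast
  finally show ?thesis by simp
qed

text \<open>Countable additivity over the values of \<open>N t\<close>. The series form lets the
  parity events be matched with the power series of \<open>sinh\<close> and
  \<open>cosh\<close>.\<close>

lemma poisson_process_prob_sums:
  assumes N: "poisson_process P l N" and t: "0 \<le> t"
  shows "(\<lambda>k. if Q k then exp (- (l * t)) * (l * t) ^ k / fact k else 0) sums
    measure P {\<omega> \<in> space P. Q (N t \<omega>)}"
proof -
  interpret prob_space P using N by (simp add: poisson_process_def)
  have [measurable]: "N t \<in> measurable P (count_space UNIV)"
    using N t by (auto simp: poisson_process_def)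
  have "(\<lambda>k. measure P {\<omega> \<in> space P. N t \<omega> = k \<and> Q k}) sums
      measure P (\<Union>k. {\<omega> \<in> space P. N t \<omega> = k \<and> Q k})"
    by (rule finite_measure_UNION) (auto simp: disjoint_family_on_def)
  also have "(\<lambda>k. measure P {\<omega> \<in> space P. N t \<omega> = k \<and> Q k}) =
      (\<lambda>k. if Q k then exp (- (l * t)) * (l * t) ^ k / fact k else 0)"
    by (auto simp: fun_eq_iff poisson_process_prob_eq[OF N t])
  also have "(\<Union>k. {\<omega> \<in> space P. N t \<omega> = k \<and> Q k}) = {\<omega> \<in> space P. Q (N t \<omega>)}"
    by auto
  finally show ?thesis .
qed

lemma poisson_process_prob_odd:
  assumes "poisson_process P m N" "0 \<le> t"
  shows "measure P {\<omega> \<in> space P. odd (N t \<omega>)} = exp (- (m * t)) * sinh (m * t)"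
proof -
  have "(\<lambda>k. exp (- (m * t)) * (if even k then 0 else (m * t) ^ k /\<^sub>R fact k)) sums
      (exp (- (m * t)) * sinh (m * t))"
    by (rule sums_mult[OF sinh_converges])
  also have "(\<lambda>k. exp (- (m * t)) * (if even k then 0 else (m * t) ^ k /\<^sub>R fact k)) =
      (\<lambda>k. if odd k then exp (- (m * t)) * (m * t) ^ k / fact k else 0)"
    by (auto simp: fun_eq_iff divide_inverse)
  finally show ?thesis
    using sums_unique2[OF poisson_process_prob_sums[OF assms, of odd]] by simp
qed

lemma poisson_process_prob_even:
  assumes "poisson_process P m N" "0 \<le> t"
  shows "measure P {\<omega> \<in> space P. even (N t \<omega>)} = exp (- (m * t)) * cosh (m * t)"
proof -
  have "(\<lambda>k. exp (- (m * t)) * (if even k then (m * t) ^ k /\<^sub>R fact k else 0)) sums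
      (exp (- (m * t)) * cosh (m * t))"
    by (rule sums_mult[OF cosh_converges])
  also have "(\<lambda>k. exp (- (m * t)) * (if even k then (m * t) ^ k /\<^sub>R fact k else 0)) =
      (\<lambda>k. if even k then exp (- (m * t)) * (m * t) ^ k / fact k else 0)"
    by (auto simp: fun_eq_iff divide_inverse)
  finally show ?thesis
    using sums_unique2[OF poisson_process_prob_sums[OF assms, of even]] by simp
qed

lemma poisson_process_prob_ge_1:
  assumes N: "poisson_process P l N" and t: "0 \<le> t"
  shows "measure P {\<omega> \<in> space P. N t \<omega> \<ge> 1} = 1 - exp (- (l * t))"
proof -
  interpret prob_space P using N by (simp add: poisson_process_def)
  have [measurable]: "N t \<in> measurable P (count_space UNIV)"
    using N t by (auto simp: poisson_process_def)
  have "prob {\<omega> \<in> space P. N t \<omega> \<ge> 1} = prob (space P - {\<omega> \<in> space P. N t \<omega> = 0})"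
    by (rule arg_cong[where f=prob]) auto
  also have "\<dots> = 1 - prob {\<omega> \<in> space P. N t \<omega> = 0}"
    by (rule prob_compl) measurable
  finally show ?thesis using poisson_process_prob_eq[OF N t, of 0] by simp
qed

text \<open>Independence is given for whole paths; composing with the coordinate projection at
  \<open>t\<close> passes it to the two values at time \<open>t\<close>.\<close>

lemma indep_processes_prob:
  assumes P: "prob_space P" and ind: "indep_processes P N N'" and t: "0 \<le> t"
  shows "measure P {\<omega> \<in> space P. Q' (N' t \<omega>) \<and> Q (N t \<omega>)} =
    measure P {\<omega> \<in> space P. Q' (N' t \<omega>)} * measure P {\<omega> \<in> space P. Q (N t \<omega>)}"
proof -
  interpret prob_space P by fact
  have comp: "(\<lambda>f. f t) \<in> measurable (Pi\<^sub>M {0..} (\<lambda>_. count_space UNIV)) (count_space UNIV)"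
    using t by (intro measurable_component_singleton) auto
  have "indep_var (count_space UNIV) (N t) (count_space UNIV) (N' t)"
    using indep_var_compose[OF ind[unfolded indep_processes_def] comp comp] t by (simp add: comp_def)
  from indep_varD[OF this, of "Collect Q" "Collect Q'"]
  have "prob ((\<lambda>\<omega>. (N t \<omega>, N' t \<omega>)) -` (Collect Q \<times> Collect Q') \<inter> space P) =
      prob (N t -` Collect Q \<inter> space P) * prob (N' t -` Collect Q' \<inter> space P)"
    by simp
  moreover have "(\<lambda>\<omega>. (N t \<omega>, N' t \<omega>)) -` (Collect Q \<times> Collect Q') \<inter> space P =
      {\<omega> \<in> space P. Q' (N' t \<omega>) \<and> Q (N t \<omega>)}"
    "N t -` Collect Q \<inter> space P = {\<omega> \<in> space P. Q (N t \<omega>)}"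
    "N' t -` Collect Q' \<inter> space P = {\<omega> \<in> space P. Q' (N' t \<omega>)}"
    by auto
  ultimately show ?thesis by simp
qed

text \<open>Turns the Poisson form of the first alternative into its closed form: independence
  splits off the factor \<open>exp (- (l * t))\<close>, the probability that \<open>N_Pi\<close> is
  still zero.\<close>

lemma indep_poisson_frechet_weights:
  assumes "poisson_process P l N_Pi" "poisson_process P m N_W" "indep_processes P N_Pi N_W" "0 \<le> t"
  shows "measure P {\<omega> \<in> space P. odd (N_W t \<omega>) \<and> N_Pi t \<omega> = 0} = exp (- (l + m) * t) * sinh (m * t)"
    and "measure P {\<omega> \<in> space P. N_Pi t \<omega> \<ge> 1} = 1 - exp (- l * t)"
    and "measure P {\<omega> \<in> space P. even (N_W t \<omega>) \<and> N_Pi t \<omega> = 0} = exp (- (l + m) * t) * cosh (m * t)"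
proof -
  have P: "prob_space P" using assms(1) by (simp add: poisson_process_def)
  have e: "exp (- (l + m) * t) = exp (- (m * t)) * exp (- (l * t))"
    by (simp add: exp_add[symmetric] algebra_simps)
  have z: "measure P {\<omega> \<in> space P. N_Pi t \<omega> = 0} = exp (- (l * t))"
    using poisson_process_prob_eq[OF assms(1,4), of 0] by simp
  show "measure P {\<omega> \<in> space P. odd (N_W t \<omega>) \<and> N_Pi t \<omega> = 0} = exp (- (l + m) * t) * sinh (m * t)"
    using indep_processes_prob[OF P assms(3,4), of odd "\<lambda>k. k = 0"] poisson_process_prob_odd[OF assms(2,4)]
    unfolding e by (simp add: z)
  show "measure P {\<omega> \<in> space P. even (N_W t \<omega>) \<and> N_Pi t \<omega> = 0} = exp (- (l + m) * t) * cosh (m * t)"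
    using indep_processes_prob[OF P assms(3,4), of even "\<lambda>k. k = 0"] poisson_process_prob_even[OF assms(2,4)]
    unfolding e by (simp add: z)
  show "measure P {\<omega> \<in> space P. N_Pi t \<omega> \<ge> 1} = 1 - exp (- l * t)"
    using poisson_process_prob_ge_1[OF assms(1,4)] by simp
qed

section \<open>Classification of the Frechet semigroups\<close>

theorem mainTheorem2:
  fixes a b :: "real \<Rightarrow> real"
    and C :: "real \<Rightarrow> real \<Rightarrow> real \<Rightarrow> real"
  assumes a: "\<And>t. t \<ge> 0 \<Longrightarrow> a t \<in> {0..1}"
    and b: "\<And>t. t \<ge> 0 \<Longrightarrow> b t \<in> {0..1}"
    and ab: "\<And>t. t \<ge> 0 \<Longrightarrow> a t + b t \<le> 1"
    and C: "\<And>t. t \<ge> 0 \<Longrightarrow> C t =\<^sub>C frechet (a t) (1 - a t - b t) (b t)"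
    and C_zero: "C 0 =\<^sub>C cop_M"
    and C_add: "\<And>s t. s \<ge> 0 \<Longrightarrow> t \<ge> 0 \<Longrightarrow> markov_product (C s) (C t) (C (s + t))"
  shows
    "(\<exists>l\<ge>0. \<exists>m\<ge>0.
        (\<forall>t\<ge>0. C t =\<^sub>C frechet (exp (- (l + m) * t) * sinh (m * t))
                             (1 - exp (- l * t))
                             (exp (- (l + m) * t) * cosh (m * t))) \<and>
        (\<forall>(P :: 'w measure) N_Pi N_W.
           poisson_process P l N_Pi \<longrightarrow> poisson_process P m N_W \<longrightarrow>
           indep_processes P N_Pi N_W \<longrightarrow>
           (\<forall>t\<ge>0. C t =\<^sub>C
              frechet (measure P {\<omega> \<in> space P. odd (N_W t \<omega>) \<and> N_Pi t \<omega> = 0})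
                      (measure P {\<omega> \<in> space P. N_Pi t \<omega> \<ge> 1})
                      (measure P {\<omega> \<in> space P. even (N_W t \<omega>) \<and> N_Pi t \<omega> = 0}))))
     \<or> (\<exists>l\<ge>0. \<forall>t>0. C t =\<^sub>C
          (\<lambda>x y. exp (- l * t) * (1 / 2 * cop_W x y + 1 / 2 * cop_M x y)
                 + (1 - exp (- l * t)) * cop_Pi x y))
     \<or> (\<forall>t>0. C t =\<^sub>C cop_Pi)"
proof -
  have sum_mult: "a (s + t) + b (s + t) = (a s + b s) * (a t + b t)"
    and diff_mult: "b (s + t) - a (s + t) = (b s - a s) * (b t - a t)" if "s > 0" "t > 0" for s t
    using markov_product_frechet_coeffs[OF C_add C C C, of s t] a[of t] b[of t] ab[of t] that by auto
  \<comment> \<open>The difference at \<open>t\<close> is the square of the difference at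
    \<open>t / 2\<close>.\<close>
  have diff_nonneg: "0 \<le> b t - a t" if "t > 0" for t
    using diff_mult[of "t / 2" "t / 2"] that by simp
  have "(\<forall>t>0. a t + b t = 0) \<or> (\<exists>l\<ge>0. \<forall>t>0. a t + b t = exp (- l * t))"
    by (rule bounded_multiplicative_zero_or_exp) (use a b ab sum_mult in force)+
  then consider "\<And>t. t > 0 \<Longrightarrow> a t + b t = 0"
    | l where "l \<ge> 0" "\<And>t. t > 0 \<Longrightarrow> a t + b t = exp (- l * t)" by blast
  then show ?thesis
  proof cases
    case 1
    have "C t =\<^sub>C cop_Pi" if t: "t > 0" for t
    proof -
      have "a t = 0" "b t = 0" using 1[OF t] a[of t] b[of t] t by auto
      then show ?thesis using C[of t] t by (simp add: copula_eq_def frechet_def)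
    qed
    then show ?thesis by blast
  next
    case (2 l)
    have "b t - a t \<le> 1" if "t > 0" for t
      using a[of t] b[of t] that by simp
    then have "(\<forall>t>0. b t - a t = 0) \<or> (\<exists>k\<ge>0. \<forall>t>0. b t - a t = exp (- k * t))"
      by (intro bounded_multiplicative_zero_or_exp diff_nonneg diff_mult)
    then consider "\<And>t. t > 0 \<Longrightarrow> b t - a t = 0"
      | k where "\<And>t. t > 0 \<Longrightarrow> b t - a t = exp (- k * t)" by blast
    then show ?thesis
    proof cases
      \<comment> \<open>W and M carry equal weight at all positive times, which is alternative
        (ii).\<close>
      case 1
      have "C t =\<^sub>C (\<lambda>x y. exp (- l * t) * (1 / 2 * cop_W x y + 1 / 2 * cop_M x y)
                 + (1 - exp (- l * t)) * cop_Pi x y)" if t: "t > 0" for t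
      proof -
        have ab: "a t = exp (- l * t) / 2" "b t = exp (- l * t) / 2"
          using 1[OF t] 2(2)[OF t] by auto
        have "frechet (a t) (1 - a t - b t) (b t) = (\<lambda>x y. exp (- l * t) *
            (1 / 2 * cop_W x y + 1 / 2 * cop_M x y) + (1 - exp (- l * t)) * cop_Pi x y)"
          unfolding ab by (simp add: fun_eq_iff frechet_def algebra_simps)
        then show ?thesis using C[of t] t by simp
      qed
      with 2(1) show ?thesis by blast
    next
      case (2 k)
      note sum_eq = \<open>\<And>t. t > 0 \<Longrightarrow> a t + b t = exp (- l * t)\<close>
      \<comment> \<open>Since \<open>a 1\<close> is nonnegative, the difference at time 1 is at most
        the sum; comparing exponents gives \<open>l \<le> k\<close>, hence \<open>m \<ge> 0\<close>
        below.\<close>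
      have "exp (- k * 1) = b 1 - a 1" "exp (- l * 1) = a 1 + b 1" "0 \<le> a 1"
        using sum_eq[of 1] 2[of 1] a[of 1] by simp_all
      then have "exp (- k * 1) \<le> exp (- l * 1)"
        by linarith
      then have lk: "l \<le> k" by simp
      \<comment> \<open>The target weight of W is half of \<open>exp (- l * t)\<close> minus
        \<open>exp (- (l + 2 * m) * t)\<close>, so matching it with half the sum minus half the
        difference forces \<open>k = l + 2 * m\<close>.\<close>
      define m where "m = (k - l) / 2"
      have m: "m \<ge> 0" using lk by (simp add: m_def)
      have form: "C t =\<^sub>C frechet (exp (- (l + m) * t) * sinh (m * t)) (1 - exp (- l * t))
                             (exp (- (l + m) * t) * cosh (m * t))" if t: "t \<ge> 0" for t
      \<comment> \<open>The exponential formulas for the weights hold only for positive times. At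
        zero the claimed weights are 0, 0, 1, and \<open>C_zero\<close> supplies the equality with
        M.\<close>
      proof (cases "t = 0")
        case True
        then show ?thesis using C_zero by (simp add: copula_eq_def frechet_def)
      next
        case False
        with t have t: "t > 0" by simp
        have e1: "exp (- (l + m) * t) * exp (m * t) = exp (- l * t)"
          by (simp add: exp_add[symmetric] algebra_simps)
        have e2: "exp (- (l + m) * t) * exp (- (m * t)) = exp (- k * t)"
          by (simp add: exp_add[symmetric] m_def field_simps)
        have "exp (- (l + m) * t) * sinh (m * t) = (exp (- l * t) - exp (- k * t)) / 2"
          "exp (- (l + m) * t) * cosh (m * t) = (exp (- l * t) + exp (- k * t)) / 2"
          unfolding e1[symmetric] e2[symmetric] by (simp_all add: sinh_def cosh_def algebra_simps)
        moreover have sum: "a t + b t = exp (- l * t)"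
          by (rule sum_eq[OF t])
        moreover have "(a t + b t - (b t - a t)) / 2 = a t" "(a t + b t + (b t - a t)) / 2 = b t"
          by simp_all
        ultimately have eqs: "exp (- (l + m) * t) * sinh (m * t) = a t"
          "exp (- (l + m) * t) * cosh (m * t) = b t" "1 - exp (- l * t) = 1 - a t - b t"
          unfolding 2[OF t, symmetric] sum[symmetric] by simp_all
        show ?thesis unfolding eqs using C t by simp
      qed
      then show ?thesis
        using \<open>l \<ge> 0\<close> m
        by (intro disjI1 exI[of _ l] exI[of _ m] conjI allI impI)
          (simp_all only: indep_poisson_frechet_weights)
    qed
  qed
qed

end
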